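(* Let $\mathcal{H}$ be a real Hilbert space, $A : \mathcal{H} \rightrightarrows \mathcal{H}$ a maximally monotone operator and $B : \mathcal{H} \to \mathcal{H}$ a $\beta$-cocoercive operator, for $\beta > 0$, such that $\operatorname{zer}(A+B) \neq \emptyset$. Consider the iterative scheme $$x_{n+1} = (1 - \lambda_n) \beta_n x_n + \lambda_n J_{\gamma_n A} \big(\beta_n x_n - \gamma_n B(\beta_n x_n)\big) \quad \forall n \geq 0,$$ with starting point $x_0 \in \mathcal{H}$ and real sequences $(\lambda_n)_{n \geq 0}$, $(\beta_n)_{n \geq 0}$ and $(\gamma_n)_{n \geq 0}$ satisfying the conditions: (i) $0 < \beta_n \leq 1$ for any $n \geq 0$, $\lim_{n \to +\infty} \beta_n = 1$, $\sum_{n \geq 0} (1 - \beta_n) = + \infty$ and $\sum_{n \geq 1} |\beta_n - \beta_{n-1}| < + \infty$; (ii) $0 < \lambda_n \leq \frac{4\beta - \gamma_n}{2\beta}$ for any $n \geq 0$, $\liminf_{n \to +\infty} \lambda_n > 0$ and $\sum_{n \geq 1} |\lambda_n - \lambda_{n-1}| < + \infty$; (iii) $0 < \gamma_n < 2\beta$ for any $n \geq 0$, $\liminf_{n \to +\infty} \gamma_n > 0$, and $\sum_{n \geq 1} |\gamma_n - \gamma_{n-1}| < + \infty$. Then $(x_n)_{n \geq 0}$ converges strongly to $\operatorname{P}_{\operatorname{zer}(A+B)}(0)$.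
   Context: $\mathcal{H}$ is a real Hilbert space with inner product $\langle \cdot,\cdot\rangle$ and induced norm $\|\cdot\|$. For a set-valued operator $A : \mathcal{H} \rightrightarrows \mathcal{H}$, $\operatorname{Gr} A := \{(x,u) \in \mathcal{H}\times\mathcal{H} : u \in Ax\}$ is its graph and $\operatorname{zer} A := \{x \in \mathcal{H} : 0 \in Ax\}$ its set of zeros; accordingly $\operatorname{zer}(A+B) = \{x \in \mathcal{H} : 0 \in Ax + Bx\}$. $A$ is monotone if $\langle x - y, u - v\rangle \geq 0$ for all $(x,u),(y,v) \in \operatorname{Gr} A$, and maximally monotone if it is monotone and its graph has no proper monotone extension in $\mathcal{H} \times \mathcal{H}$. The resolvent of $A$ is $J_A := (\operatorname{Id} + A)^{-1}$, with $\operatorname{Id}$ the identity on $\mathcal{H}$; it is single-valued and defined on all of $\mathcal{H}$ when $A$ is maximally monotone. A single-valued operator $B : \mathcal{H} \to \mathcal{H}$ is $\beta$-cocoercive, for $\beta > 0$, if $\langle x - y, Bx - By\rangle \geq \beta \|Bx - By\|^2$ for all $x, y \in \mathcal{H}$. For a nonempty convex closed set $C \subseteq \mathcal{H}$, $\operatorname{P}_C(x) := \operatorname{argmin}_{c \in C} \|x - c\|$ is the projection onto $C$; thus $\operatorname{P}_C(0)$ is the element of $C$ with minimum norm. The constant $\beta$ is unrelated to the sequence $(\beta_n)_{n\ge 0}$. *)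

theory Defs
  imports "HOL-Analysis.Analysis"
begin

text \<open>A set-valued operator on a space \<open>'a\<close> is a function of type \<open>'a \<Rightarrow> 'a set\<close>. Sums of sets are
  Minkowski sums (\<open>HOL-Library.Set_Algebras\<close>), and a point occurring in such a sum is
  written as a singleton.\<close>

definition graph_of :: "('a \<Rightarrow> 'a set) \<Rightarrow> ('a \<times> 'a) set" where
  "graph_of A = {(x, u). u \<in> A x}"

definition zeros :: "('a::zero \<Rightarrow> 'a set) \<Rightarrow> 'a set" where
  "zeros A = {x. 0 \<in> A x}"

definition monotone_operator :: "('a::real_inner \<Rightarrow> 'a set) \<Rightarrow> bool" where
  "monotone_operator A \<longleftrightarrow>
     (\<forall>(x, u) \<in> graph_of A. \<forall>(y, v) \<in> graph_of A. inner (x - y) (u - v) \<ge> 0)"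

definition maximally_monotone :: "('a::real_inner \<Rightarrow> 'a set) \<Rightarrow> bool" where
  "maximally_monotone A \<longleftrightarrow> monotone_operator A \<and>
     \<not> (\<exists>A'. monotone_operator A' \<and> graph_of A \<subset> graph_of A')"

definition cocoercive :: "real \<Rightarrow> ('a::real_inner \<Rightarrow> 'a) \<Rightarrow> bool" where
  "cocoercive \<beta> B \<longleftrightarrow>
     (\<forall>x y. inner (x - y) (B x - B y) \<ge> \<beta> * (norm (B x - B y))\<^sup>2)"

definition inverse_operator :: "('a \<Rightarrow> 'a set) \<Rightarrow> 'a \<Rightarrow> 'a set" where
  "inverse_operator A u = {x. u \<in> A x}"

definition scale_operator :: "real \<Rightarrow> ('a::real_vector \<Rightarrow> 'a set) \<Rightarrow> 'a \<Rightarrow> 'a set" where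
  "scale_operator c A x = (\<lambda>u. c *\<^sub>R u) ` A x"

definition resolvent_set :: "('a::real_vector \<Rightarrow> 'a set) \<Rightarrow> 'a \<Rightarrow> 'a set" where
  "resolvent_set A = inverse_operator (\<lambda>x. {x} + A x)"

text \<open>The resolvent as a single-valued map. The value at \<open>y\<close> is meaningful only if
  \<open>resolvent_set A y\<close> is a singleton, which holds for every \<open>y\<close> if \<open>A\<close> is maximally monotone
  on a Hilbert space (Minty's theorem); it is unspecified otherwise.\<close>

definition resolvent :: "('a::real_vector \<Rightarrow> 'a set) \<Rightarrow> 'a \<Rightarrow> 'a" where
  "resolvent A y = the_elem (resolvent_set A y)"

text \<open>The library's \<open>closest_point\<close> is restricted to Heine-Borel spaces, which excludes
  infinite-dimensional Hilbert spaces. The minimizer below exists and is unique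
  for nonempty closed convex \<open>C\<close> in a Hilbert space.\<close>

definition projection :: "'a::real_normed_vector set \<Rightarrow> 'a \<Rightarrow> 'a" where
  "projection C x = arg_min_on (\<lambda>c. norm (x - c)) C"

end

theory Submission
  imports Defs
begin

text \<open>Let \<open>\<beta>\<^sub>n\<close> and \<open>\<lambda>\<^sub>n\<close> denote the terms of \<open>b\<close> and \<open>lam\<close>. Write \<open>T\<^sub>n\<close> for the forward-backward map \<open>u \<mapsto> J (u - \<gamma>\<^sub>n B u)\<close>, where \<open>J\<close> is the
  resolvent of \<open>\<gamma>\<^sub>n A\<close>, and \<open>u\<^sub>n = \<beta>\<^sub>n x\<^sub>n\<close>. The fixed points of every \<open>T\<^sub>n\<close> are the zeros of
  \<open>A + B\<close>, and the bound on \<open>\<lambda>\<^sub>n\<close> is what makes the relaxed map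
  \<open>S\<^sub>n = (1 - \<lambda>\<^sub>n) Id + \<lambda>\<^sub>n T\<^sub>n\<close> nonexpansive (\<open>relaxed_forward_backward_nonexpansive\<close>).
  The scheme \<open>x\<^sub>n\<^sub>+\<^sub>1 = S\<^sub>n (\<beta>\<^sub>n x\<^sub>n)\<close> thus alternates a nonexpansive step with a shrinking towards
  the origin; the latter acts as a Tikhonov regularization and selects the solution of least norm.

  The steps \<open>x\<^sub>n\<^sub>+\<^sub>1 - x\<^sub>n\<close> are contracted by \<open>\<beta>\<^sub>n\<close> up to errors that are summable because the
  parameters have bounded variation. As \<open>\<Sum>(1 - \<beta>\<^sub>n)\<close> diverges, the steps tend to \<open>0\<close>
  (\<open>asymptotic_regularity\<close>, by \<open>perturbed_recursion_tendsto_0\<close>), and so do the displacements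
  \<open>u\<^sub>n - T u\<^sub>n\<close>, where \<open>T\<close> is the forward-backward map with the limit step size.

  Let \<open>p\<close> be the least-norm fixed point of \<open>T\<close>. Nonexpansiveness of \<open>S\<^sub>n\<close> gives
  \<open>\<parallel>x\<^sub>n\<^sub>+\<^sub>1 - p\<parallel>\<^sup>2 \<le> \<parallel>u\<^sub>n - p\<parallel>\<^sup>2 \<le> \<beta>\<^sub>n \<parallel>x\<^sub>n - p\<parallel>\<^sup>2 - 2 (1 - \<beta>\<^sub>n) \<langle>p, u\<^sub>n - p\<rangle>\<close>,
  so the same recursive inequality yields \<open>x\<^sub>n \<rightarrow> p\<close> once \<open>\<langle>p, u\<^sub>n - p\<rangle>\<close> has a nonnegative limit
  inferior. The usual argument for this takes weak cluster points of \<open>u\<^sub>n\<close> and uses the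
  demiclosedness of \<open>Id - T\<close>. Here weak compactness is avoided by means of the Tikhonov path
  \<open>T w = (1 + \<epsilon>) w\<close>: it converges strongly to \<open>p\<close> as \<open>\<epsilon> \<rightarrow> 0\<close> (\<open>tikhonov_path_converges\<close>), and
  monotonicity of \<open>Id - T\<close>, applied to \<open>u\<^sub>n\<close> and \<open>w\<close>, bounds \<open>\<langle>w, u\<^sub>n - w\<rangle>\<close> from below by a multiple
  of \<open>-\<parallel>u\<^sub>n - T u\<^sub>n\<parallel>\<close> (\<open>asymptotic_fixed_points_half_space\<close>). The same path shows
  that the projection of \<open>0\<close> onto the set of zeros exists and is \<open>p\<close>.

  All this requires the resolvent to be single-valued and defined everywhere, which is Minty's
  theorem; it is proved by minimizing a strongly convex function built from the Fitzpatrick function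
  of the operator.\<close>

section \<open>Recursive inequalities for real sequences\<close>

text \<open>Unrolling the recursion multiplies the initial value by \<open>\<Prod>(1 - \<theta>\<^sub>k) \<le> exp (- \<Sum>\<theta>\<^sub>k)\<close>, while the
  convex combinations with \<open>e\<close> never exceed \<open>e\<close> and the errors \<open>\<eta>\<close> at worst accumulate.\<close>

lemma perturbed_recursion_bound:
  fixes a \<theta> \<eta> :: "nat \<Rightarrow> real"
  assumes a0: "\<And>n. 0 \<le> a n" and th: "\<And>n. 0 \<le> \<theta> n \<and> \<theta> n \<le> 1"
    and eta: "\<And>n. 0 \<le> \<eta> n" and e: "0 \<le> e"
    and rec: "\<And>n. a (Suc n) \<le> (1 - \<theta> n) * a n + \<theta> n * e + \<eta> n"
  shows "a m \<le> a 0 * exp (- (\<Sum>k<m. \<theta> k)) + e + (\<Sum>k<m. \<eta> k)"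
proof (induction m)
  case 0
  then show ?case using e by simp
next
  case (Suc m)
  have "1 - \<theta> m \<le> exp (- \<theta> m)" using exp_ge_add_one_self[of "- \<theta> m"] by simp
  hence "(1 - \<theta> m) * (a 0 * exp (- (\<Sum>k<m. \<theta> k))) \<le> exp (- \<theta> m) * (a 0 * exp (- (\<Sum>k<m. \<theta> k)))"
    by (rule mult_right_mono) (simp add: a0)
  also have "\<dots> = a 0 * exp (- (\<Sum>k<Suc m. \<theta> k))" by (simp add: exp_add[symmetric] exp_diff exp_minus field_simps)
  finally have 1: "(1 - \<theta> m) * (a 0 * exp (- (\<Sum>k<m. \<theta> k))) \<le> a 0 * exp (- (\<Sum>k<Suc m. \<theta> k))" .
  have 2: "(1 - \<theta> m) * (\<Sum>k<m. \<eta> k) \<le> (\<Sum>k<m. \<eta> k)"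
    using th[of m] eta by (intro mult_left_le_one_le sum_nonneg) auto
  have "a (Suc m) \<le> (1 - \<theta> m) * (a 0 * exp (- (\<Sum>k<m. \<theta> k)) + e + (\<Sum>k<m. \<eta> k)) + \<theta> m * e + \<eta> m"
    using rec[of m] mult_left_mono[OF Suc.IH, of "1 - \<theta> m"] th[of m] by simp
  also have "\<dots> = (1 - \<theta> m) * (a 0 * exp (- (\<Sum>k<m. \<theta> k))) + e + (1 - \<theta> m) * (\<Sum>k<m. \<eta> k) + \<eta> m"
    by (simp add: algebra_simps)
  also have "\<dots> \<le> a 0 * exp (- (\<Sum>k<Suc m. \<theta> k)) + e + (\<Sum>k<Suc m. \<eta> k)"
    using 1 2 by simp
  finally show ?case .
qed

lemma sum_at_top_shift:
  fixes f :: "nat \<Rightarrow> real"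
  assumes "filterlim (\<lambda>N. \<Sum>n<N. f n) at_top sequentially"
  shows "filterlim (\<lambda>N. \<Sum>n<N. f (n + k)) at_top sequentially"
proof -
  have "filterlim (\<lambda>N. (\<Sum>n<N + k. f n)) at_top sequentially"
    using filterlim_compose[OF assms filterlim_add_const_nat_at_top] by simp
  hence "filterlim (\<lambda>N. - (\<Sum>n<k. f n) + (\<Sum>n<N + k. f n)) at_top sequentially"
    by (intro filterlim_tendsto_add_at_top[OF tendsto_const])
  moreover have "- (\<Sum>n<k. f n) + (\<Sum>n<N + k. f n) = (\<Sum>n<N. f (n + k))" for N
    by (induction N) auto
  ultimately show ?thesis by simp
qed

text \<open>From a late index on, \<open>\<delta>\<close> is at most \<open>e\<close> and the remaining errors sum to less than \<open>e\<close>; the bound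
  above then exceeds \<open>2 e\<close> only by the contribution of the starting value, which the
  divergence of \<open>\<Sum>\<theta>\<close> drives to \<open>0\<close>.\<close>

lemma perturbed_recursion_tendsto_0:
  fixes a \<theta> \<delta> \<eta> :: "nat \<Rightarrow> real"
  assumes a0: "\<And>n. 0 \<le> a n" and th: "\<And>n. 0 \<le> \<theta> n \<and> \<theta> n \<le> 1"
    and div: "filterlim (\<lambda>N. \<Sum>n<N. \<theta> n) at_top sequentially"
    and del: "\<And>e. e > 0 \<Longrightarrow> \<forall>\<^sub>F n in sequentially. \<delta> n \<le> e"
    and eta: "\<And>n. 0 \<le> \<eta> n" and sm: "summable \<eta>"
    and rec: "\<And>n. a (Suc n) \<le> (1 - \<theta> n) * a n + \<theta> n * \<delta> n + \<eta> n"
  shows "a \<longlonglongrightarrow> 0"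
proof (rule LIMSEQ_I)
  fix r :: real assume r: "r > 0"
  define e where "e = r / 3"
  have e: "e > 0" using r by (simp add: e_def)
  obtain N1 where N1: "\<And>n. n \<ge> N1 \<Longrightarrow> \<delta> n \<le> e"
    using del[OF e] by (auto simp: eventually_sequentially)
  obtain N2 where N2: "\<And>n. n \<ge> N2 \<Longrightarrow> norm (\<Sum>i. \<eta> (i + n)) < e"
    using suminf_exist_split[OF e sm] by blast
  define N where "N = max N1 N2"
  have "N1 \<le> N" by (simp add: N_def)
  have bnd: "a (m + N) \<le> a N * exp (- (\<Sum>k<m. \<theta> (k + N))) + e + (\<Sum>k<m. \<eta> (k + N))" for m
  proof -
    have "a (Suc (n + N)) \<le> (1 - \<theta> (n + N)) * a (n + N) + \<theta> (n + N) * e + \<eta> (n + N)" for n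
      using rec[of "n + N"] mult_left_mono[OF N1[of "n + N"], of "\<theta> (n + N)"] th[of "n + N"] \<open>N1 \<le> N\<close>
      by simp
    thus ?thesis
      using perturbed_recursion_bound[of "\<lambda>n. a (n + N)" "\<lambda>n. \<theta> (n + N)" "\<lambda>n. \<eta> (n + N)" e m]
        a0 th eta e by simp
  qed
  have tail: "(\<Sum>k<m. \<eta> (k + N)) < e" for m
  proof -
    have "(\<Sum>k<m. \<eta> (k + N)) \<le> (\<Sum>k. \<eta> (k + N))"
      using sm eta by (intro sum_le_suminf) (auto simp: summable_iff_shift)
    thus ?thesis using N2[of N] by (simp add: N_def)
  qed
  have "(\<lambda>m. a N * exp (- (\<Sum>k<m. \<theta> (k + N)))) \<longlonglongrightarrow> a N * 0"
    by (intro tendsto_mult tendsto_const filterlim_compose[OF exp_at_bot]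
        filterlim_compose[OF filterlim_uminus_at_bot_at_top] sum_at_top_shift div)
  hence "\<forall>\<^sub>F m in sequentially. a N * exp (- (\<Sum>k<m. \<theta> (k + N))) < e"
    using e by (intro order_tendstoD(2)) auto
  then obtain M where M: "\<And>m. m \<ge> M \<Longrightarrow> a N * exp (- (\<Sum>k<m. \<theta> (k + N))) < e"
    by (auto simp: eventually_sequentially)
  have "norm (a n - 0) < r" if "n \<ge> M + N" for n
    using bnd[of "n - N"] tail[of "n - N"] M[of "n - N"] a0[of n] that by (simp add: e_def le_diff_conv2)
  thus "\<exists>no. \<forall>n\<ge>no. norm (a n - 0) < r" by blast
qed

lemma bounded_variation_pos_limit:
  fixes f :: "nat \<Rightarrow> real"
  assumes "summable (\<lambda>n. \<bar>f (Suc n) - f n\<bar>)" and "liminf (\<lambda>n. ereal (f n)) > 0"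
  obtains L where "f \<longlonglongrightarrow> L" "L > 0"
proof -
  have "(\<lambda>n. \<Sum>k<n. f (Suc k) - f k) \<longlonglongrightarrow> (\<Sum>k. f (Suc k) - f k)"
    by (rule summable_LIMSEQ[OF summable_rabs_cancel[OF assms(1)]])
  hence "(\<lambda>n. (f n - f 0) + f 0) \<longlonglongrightarrow> (\<Sum>k. f (Suc k) - f k) + f 0"
    by (intro tendsto_add tendsto_const) (simp add: sum_lessThan_telescope)
  then obtain L where L: "f \<longlonglongrightarrow> L" by auto
  obtain c where c: "0 < ereal c" "ereal c < liminf (\<lambda>n. ereal (f n))"
    using ereal_dense2[OF assms(2)] by blast
  have "\<forall>\<^sub>F n in sequentially. c \<le> f n"
    using less_LiminfD[OF c(2)] by eventually_elim simp
  hence "c \<le> L" by (intro tendsto_lowerbound[OF L]) auto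
  thus ?thesis using that L c by simp
qed

section \<open>Minty's theorem\<close>

lemma maximally_monotoneD:
  assumes "maximally_monotone A" "u \<in> A x" "v \<in> A y"
  shows "inner (x - y) (u - v) \<ge> 0"
  using assms unfolding maximally_monotone_def monotone_operator_def graph_of_def by fastforce

text \<open>Maximality in its usable form: a pair monotonically related to the whole graph lies in the graph,
  since adding it would otherwise give a proper monotone extension.\<close>

lemma maximally_monotone_mem:
  fixes A :: "'a::real_inner \<Rightarrow> 'a set"
  assumes max: "maximally_monotone A"
    and rel: "\<And>y v. v \<in> A y \<Longrightarrow> inner (x - y) (u - v) \<ge> 0"
  shows "u \<in> A x"
proof (rule ccontr)
  assume nin: "u \<notin> A x"
  define A' where "A' = A(x := insert u (A x))"
  have cases: "(v \<in> A' y) \<longleftrightarrow> (v \<in> A y \<or> (y = x \<and> v = u))" for v y by (auto simp: A'_def)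
  have "inner (y - x) (v - u) \<ge> 0" if "v \<in> A y" for y v
    using rel[OF that] by (metis inner_minus_left inner_minus_right minus_diff_eq)
  hence "inner (y - y') (v - v') \<ge> 0" if "v \<in> A' y" "v' \<in> A' y'" for y y' v v'
    using that rel maximally_monotoneD[OF max] unfolding cases by auto
  hence "monotone_operator A'" unfolding monotone_operator_def graph_of_def by auto
  moreover have "graph_of A \<subset> graph_of A'"
    using nin cases[of u x] cases unfolding graph_of_def by blast
  ultimately show False using max unfolding maximally_monotone_def by blast
qed

text \<open>The set \<open>K\<close> stands for the epigraph of an extended-real convex function, so that values
  \<open>+\<infinity>\<close> never have to be mentioned. The functional \<open>t + \<parallel>p\<parallel>\<^sup>2 / 2\<close> is strongly convex in \<open>p\<close>: comparing
  its values at two points with that at their midpoint shows that minimizing sequences are Cauchy.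
  The inequality satisfied at the minimizer is the first-order optimality condition.\<close>

lemma strongly_convex_minimizer:
  fixes K :: "('h::{real_inner, complete_space} \<times> real) set"
  assumes cl: "closed K" and cv: "convex K" and ne: "K \<noteq> {}"
    and lb: "\<And>p t. (p, t) \<in> K \<Longrightarrow> m \<le> t + (norm p)\<^sup>2 / 2"
  obtains p t where "(p, t) \<in> K" "\<And>q s. (q, s) \<in> K \<Longrightarrow> 0 \<le> s - t + inner p (q - p)"
proof -
  define \<phi> where "\<phi> = (\<lambda>z::'h \<times> real. snd z + (norm (fst z))\<^sup>2 / 2)"
  define \<mu> where "\<mu> = Inf (\<phi> ` K)"
  have bdd: "bdd_below (\<phi> ` K)" using lb by (intro bdd_belowI[of _ m]) (auto simp: \<phi>_def)
  have mu: "\<mu> \<le> \<phi> z" if "z \<in> K" for z using bdd that by (simp add: \<mu>_def cINF_lower)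
  have "\<exists>z\<in>K. \<phi> z < \<mu> + 1 / real (Suc n)" for n
    using cINF_less_iff[OF ne bdd, of "\<mu> + 1 / real (Suc n)"] by (auto simp: \<mu>_def)
  then obtain z where zK: "\<And>n. z n \<in> K" and zphi: "\<And>n. \<phi> (z n) < \<mu> + 1 / real (Suc n)" by metis
  \<comment> \<open>The parallelogram identity turns near-minimality at both points into closeness.\<close>
  have gap: "(norm (fst (z i) - fst (z j)))\<^sup>2 \<le> 4 * (1 / real (Suc i) + 1 / real (Suc j))" for i j
  proof -
    have mid: "(1/2) *\<^sub>R z i + (1/2) *\<^sub>R z j \<in> K"
      using cv zK[of i] zK[of j] by (auto simp: convex_def)
    have "\<phi> ((1/2) *\<^sub>R z i + (1/2) *\<^sub>R z j)
        = \<phi> (z i) / 2 + \<phi> (z j) / 2 - (norm (fst (z i) - fst (z j)))\<^sup>2 / 8"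
      by (simp add: \<phi>_def power2_norm_eq_inner inner_add_left inner_add_right inner_diff_left
          inner_diff_right inner_commute field_simps)
    thus ?thesis using mu[OF mid] zphi[of i] zphi[of j] by simp
  qed
  have inv0: "(\<lambda>n. 1 / real (Suc n)) \<longlonglongrightarrow> 0" using LIMSEQ_inverse_real_of_nat by (simp add: inverse_eq_divide)
  have "Cauchy (\<lambda>n. fst (z n))"
  proof (rule CauchyI)
    fix e :: real assume e: "e > 0"
    have "\<forall>\<^sub>F n in sequentially. 1 / real (Suc n) < e\<^sup>2 / 8"
      using e by (intro order_tendstoD(2)[OF inv0]) auto
    then obtain M where M: "\<And>n. n \<ge> M \<Longrightarrow> 1 / real (Suc n) < e\<^sup>2 / 8"
      by (auto simp: eventually_sequentially)
    have "norm (fst (z i) - fst (z j)) < e" if "i \<ge> M" "j \<ge> M" for i j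
    proof -
      have "(norm (fst (z i) - fst (z j)))\<^sup>2 < e\<^sup>2" using gap[of i j] M[OF that(1)] M[OF that(2)] by simp
      thus ?thesis using e power_less_imp_less_base by fastforce
    qed
    thus "\<exists>M. \<forall>i\<ge>M. \<forall>j\<ge>M. norm (fst (z i) - fst (z j)) < e" by blast
  qed
  then obtain p where p: "(\<lambda>n. fst (z n)) \<longlonglongrightarrow> p" using Cauchy_convergent_iff convergent_def by blast
  have phi_lim: "(\<lambda>n. \<phi> (z n)) \<longlonglongrightarrow> \<mu>"
  proof (rule tendsto_sandwich)
    show "\<forall>\<^sub>F n in sequentially. \<mu> \<le> \<phi> (z n)" using mu zK by simp
    show "\<forall>\<^sub>F n in sequentially. \<phi> (z n) \<le> \<mu> + 1 / real (Suc n)" using zphi by (simp add: less_imp_le)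
    show "(\<lambda>n. \<mu> + 1 / real (Suc n)) \<longlonglongrightarrow> \<mu>" using tendsto_add[OF tendsto_const inv0] by simp
  qed simp
  define t where "t = \<mu> - (norm p)\<^sup>2 / 2"
  have "(\<lambda>n. \<phi> (z n) - (norm (fst (z n)))\<^sup>2 / 2) \<longlonglongrightarrow> t"
    unfolding t_def by (intro tendsto_intros phi_lim p) simp
  hence "(\<lambda>n. snd (z n)) \<longlonglongrightarrow> t" by (simp add: \<phi>_def)
  hence "(\<lambda>n. (fst (z n), snd (z n))) \<longlonglongrightarrow> (p, t)" using p by (intro tendsto_Pair)
  hence "z \<longlonglongrightarrow> (p, t)" by simp
  hence ptK: "(p, t) \<in> K" using closed_sequentially[OF cl] zK by blast
  have var: "0 \<le> s - t + inner p (q - p)" if qs: "(q, s) \<in> K" for q s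
  proof -
    define d where "d = q - p"
    \<comment> \<open>Move from the minimizer a fraction \<open>r\<close> of the way to \<open>(q, s)\<close>, divide by \<open>r\<close> and let \<open>r \<rightarrow> 0\<close>.\<close>
    have step: "0 \<le> s - t + inner p d + r * ((norm d)\<^sup>2 / 2)" if r: "0 < r" "r < 1" for r
    proof -
      have "(1 - r) *\<^sub>R (p, t) + r *\<^sub>R (q, s) \<in> K"
        using cv ptK qs r convexD[of K "(p, t)" "(q, s)" "1 - r" r] by simp
      from mu[OF this] have "\<mu> \<le> (1 - r) * t + r * s + (norm ((1 - r) *\<^sub>R p + r *\<^sub>R q))\<^sup>2 / 2"
        by (simp add: \<phi>_def)
      also have "(1 - r) *\<^sub>R p + r *\<^sub>R q = p + r *\<^sub>R d" by (simp add: d_def algebra_simps)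
      also have "(norm (p + r *\<^sub>R d))\<^sup>2 = (norm p)\<^sup>2 + 2 * r * inner p d + r * r * (norm d)\<^sup>2"
        unfolding power2_norm_eq_inner
        by (simp add: inner_add_left inner_add_right inner_commute[of d p] algebra_simps)
      finally have "0 \<le> r * (s - t + inner p d + r * ((norm d)\<^sup>2 / 2))"
        by (simp add: t_def algebra_simps add_divide_distrib diff_divide_distrib)
      thus ?thesis using r by (simp add: zero_le_mult_iff)
    qed
    have "((\<lambda>r. s - t + inner p d + r * ((norm d)\<^sup>2 / 2))
        \<longlongrightarrow> s - t + inner p d + 0 * ((norm d)\<^sup>2 / 2)) (at_right 0)"
      by (intro tendsto_intros)
    moreover have "\<forall>\<^sub>F r in at_right 0. 0 \<le> s - t + inner p d + r * ((norm d)\<^sup>2 / 2)"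
      using eventually_at_right_real[OF zero_less_one] step by (auto elim!: eventually_mono)
    ultimately have "0 \<le> s - t + inner p d + 0 * ((norm d)\<^sup>2 / 2)"
      by (rule tendsto_lowerbound) simp
    thus ?thesis by (simp add: d_def)
  qed
  show thesis using that ptK var by blast
qed

text \<open>The set \<open>K\<close> below is the epigraph of the Fitzpatrick function
  \<open>F (x, u) = sup {\<langle>x, \<alpha>\<rangle> + \<langle>a, u\<rangle> - \<langle>a, \<alpha>\<rangle> | (a, \<alpha>) \<in> G}\<close>. Maximal monotonicity gives \<open>F (x, u) \<ge> \<langle>x, u\<rangle>\<close>, with
  equality on \<open>G\<close>, so \<open>F + (\<parallel>x\<parallel>\<^sup>2 + \<parallel>u\<parallel>\<^sup>2) / 2\<close> is bounded below by \<open>\<parallel>x + u\<parallel>\<^sup>2 / 2\<close> and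
  has a minimizer \<open>(x, u)\<close>. Its optimality condition, tested on \<open>G\<close>, says that \<open>(-u, -x)\<close>
  is monotonically related to \<open>G\<close>, hence lies in it; tested at this very point, it forces \<open>x + u = 0\<close>.\<close>

lemma minty_at_0:
  fixes G :: "('a::{real_inner, complete_space} \<times> 'a) set"
  assumes mono: "\<And>x u y v. (x, u) \<in> G \<Longrightarrow> (y, v) \<in> G \<Longrightarrow> 0 \<le> inner (x - y) (u - v)"
    and max: "\<And>x u. (\<And>y v. (y, v) \<in> G \<Longrightarrow> 0 \<le> inner (x - y) (u - v)) \<Longrightarrow> (x, u) \<in> G"
  obtains x where "(x, - x) \<in> G"
proof -
  define K where "K = (\<Inter>(a, \<alpha>)\<in>G. {(p, t). inner (fst p) \<alpha> + inner a (snd p) - inner a \<alpha> \<le> (t::real)})"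
  have K: "((x, u), t) \<in> K \<longleftrightarrow> (\<forall>(a, \<alpha>)\<in>G. inner x \<alpha> + inner a u - inner a \<alpha> \<le> t)" for x u t
    by (auto simp: K_def)
  have "closed K" unfolding K_def case_prod_unfold
    by (intro closed_INT ballI closed_Collect_le continuous_intros)
  moreover have "convex K" unfolding K_def
  proof (rule convex_INT, clarify)
    fix a \<alpha>
    have "convex {z. inner z ((\<alpha>, a), - 1::real) \<le> inner a \<alpha>}" 
      using convex_halfspace_le[of "((\<alpha>, a), - 1::real)" "inner a \<alpha>"] by (simp add: inner_commute)
    moreover have "{z. inner z ((\<alpha>, a), - 1::real) \<le> inner a \<alpha>}
      = {(p, t). inner (fst p) \<alpha> + inner a (snd p) - inner a \<alpha> \<le> (t::real)}"
      by (auto simp: inner_prod_def inner_commute algebra_simps)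
    ultimately show "convex {(p, t). inner (fst p) \<alpha> + inner a (snd p) - inner a \<alpha> \<le> (t::real)}" by simp
  qed
  moreover have GK: "((x, u), inner x u) \<in> K" if "(x, u) \<in> G" for x u
  proof -
    have "inner x v + inner y u - inner y v \<le> inner x u" if "(y, v) \<in> G" for y v
      using mono[OF \<open>(x, u) \<in> G\<close> that] by (simp add: inner_diff_left inner_diff_right)
    thus ?thesis by (auto simp: K)
  qed
  moreover have "G \<noteq> {}" using max[of 0 0] by auto
  ultimately have K3: "closed K" "convex K" "K \<noteq> {}" by auto
  have lower: "inner x u \<le> t" if "((x, u), t) \<in> K" for x u t
  proof (cases "(x, u) \<in> G")
    case True
    with that have "inner x u + inner x u - inner x u \<le> t" unfolding K by blast
    thus ?thesis by simp
  next
    case False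
    then obtain y v where yv: "(y, v) \<in> G" "inner (x - y) (u - v) < 0" using max[of x u] by (meson not_le)
    have "inner x v + inner y u - inner y v \<le> t" using that yv(1) by (auto simp: K)
    thus ?thesis using yv(2) by (simp add: inner_diff_left inner_diff_right)
  qed
  have sq: "(norm (x + u))\<^sup>2 = (norm x)\<^sup>2 + (norm u)\<^sup>2 + 2 * inner x u" for x u :: 'a
    by (simp add: power2_norm_eq_inner inner_add_left inner_add_right inner_commute[of u x])
  have "0 \<le> t + (norm p)\<^sup>2 / 2" if "(p, t) \<in> K" for p t
  proof -
    obtain x u where p: "p = (x, u)" by (cases p)
    have "(norm p)\<^sup>2 = (norm (x + u))\<^sup>2 - 2 * inner x u" unfolding sq by (simp add: p norm_Pair)
    moreover have "inner x u \<le> t" using lower that by (simp add: p)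
    moreover have "0 \<le> (norm (x + u))\<^sup>2" by simp
    ultimately show ?thesis by linarith
  qed
  then obtain p t where pt: "(p, t) \<in> K" "\<And>q s. (q, s) \<in> K \<Longrightarrow> 0 \<le> s - t + inner p (q - p)"
    using strongly_convex_minimizer[OF K3, of 0] by metis
  obtain x u where p: "p = (x, u)" by (cases p)
  have low: "inner x u \<le> t" using lower pt(1) p by simp
  have key: "(norm (x + u))\<^sup>2 \<le> inner (a + u) (\<alpha> + x)" if "(a, \<alpha>) \<in> G" for a \<alpha>
  proof -
    have "0 \<le> inner a \<alpha> - t + inner x (a - x) + inner u (\<alpha> - u)"
      using pt(2)[OF GK[OF that]] p by (simp add: inner_prod_def algebra_simps)
    thus ?thesis using low sq[of x u]
      by (simp add: power2_norm_eq_inner inner_add_left inner_add_right inner_diff_right inner_commute)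
  qed
  have "0 \<le> inner (- u - a) (- x - \<alpha>)" if "(a, \<alpha>) \<in> G" for a \<alpha>
  proof -
    have "inner (- u - a) (- x - \<alpha>) = inner (a + u) (\<alpha> + x)"
      by (simp add: inner_diff_left inner_diff_right inner_add_left inner_add_right)
    thus ?thesis using key[OF that] by (smt (verit) zero_le_power2)
  qed
  hence mem: "(- u, - x) \<in> G" by (rule max)
  from key[OF mem] have "x + u = 0" by simp
  hence "- u = x" by (simp add: add_eq_0_iff)
  thus thesis using that mem by metis
qed

text \<open>Scaling the values of \<open>A\<close> by \<open>\<gamma>\<close> and shifting them by \<open>- v\<close> preserves maximal monotonicity and moves
  the equation to be solved to \<open>0 \<in> y + (\<gamma> A y - v)\<close>.\<close>

lemma minty:
  fixes A :: "'a::{real_inner, complete_space} \<Rightarrow> 'a set"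
  assumes A: "maximally_monotone A" and \<gamma>: "\<gamma> > 0"
  obtains y u where "u \<in> A y" "y + \<gamma> *\<^sub>R u = v"
proof -
  define G where "G = {(y, w). (1 / \<gamma>) *\<^sub>R (w + v) \<in> A y}"
  have expand: "inner (y - y') (w - w') = \<gamma> * inner (y - y') ((1/\<gamma>) *\<^sub>R (w + v) - (1/\<gamma>) *\<^sub>R (w' + v))"
    for y y' w w' :: 'a
    using \<gamma> by (simp add: scaleR_diff_right[symmetric])
  have mono: "0 \<le> inner (y - y') (w - w')" if "(y, w) \<in> G" "(y', w') \<in> G" for y w y' w'
    using maximally_monotoneD[OF A, of "(1/\<gamma>) *\<^sub>R (w + v)" y "(1/\<gamma>) *\<^sub>R (w' + v)" y'] that \<gamma>
    by (simp add: G_def expand[of y y' w w'])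
  have max: "(y, w) \<in> G" if h: "\<And>y' w'. (y', w') \<in> G \<Longrightarrow> 0 \<le> inner (y - y') (w - w')" for y w
  proof -
    have "0 \<le> inner (y - y') ((1/\<gamma>) *\<^sub>R (w + v) - u)" if "u \<in> A y'" for y' u
    proof -
      have "(1/\<gamma>) *\<^sub>R ((\<gamma> *\<^sub>R u - v) + v) = u" using \<gamma> by simp
      thus ?thesis using h[of y' "\<gamma> *\<^sub>R u - v"] that \<gamma> expand[of y y' w "\<gamma> *\<^sub>R u - v"]
        by (simp add: G_def zero_le_mult_iff)
    qed
    thus ?thesis using maximally_monotone_mem[OF A] by (simp add: G_def)
  qed
  obtain y where "(y, - y) \<in> G" using minty_at_0[OF mono max] by blast
  hence "(1/\<gamma>) *\<^sub>R (v - y) \<in> A y" by (simp add: G_def)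
  moreover have "y + \<gamma> *\<^sub>R ((1/\<gamma>) *\<^sub>R (v - y)) = v" using \<gamma> by simp
  ultimately show thesis using that by blast
qed

lemma mem_resolvent_set_scale:
  assumes "\<gamma> \<noteq> 0"
  shows "y \<in> resolvent_set (scale_operator \<gamma> A) v \<longleftrightarrow> (1 / \<gamma>) *\<^sub>R (v - y) \<in> A y"
proof -
  have "v = y + \<gamma> *\<^sub>R u \<longleftrightarrow> u = (1 / \<gamma>) *\<^sub>R (v - y)" for u
    using assms by auto
  thus ?thesis
    by (auto simp: resolvent_set_def inverse_operator_def scale_operator_def set_plus_def)
qed

lemma resolvent_scale_iff:
  fixes A :: "'a::{real_inner, complete_space} \<Rightarrow> 'a set"
  assumes A: "maximally_monotone A" and \<gamma>: "\<gamma> > 0"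
  shows "resolvent (scale_operator \<gamma> A) v = y \<longleftrightarrow> (1 / \<gamma>) *\<^sub>R (v - y) \<in> A y"
proof -
  let ?R = "resolvent_set (scale_operator \<gamma> A) v"
  have mem: "y \<in> ?R \<longleftrightarrow> (1 / \<gamma>) *\<^sub>R (v - y) \<in> A y" for y
    using \<gamma> by (simp add: mem_resolvent_set_scale)
  obtain y0 u0 where y0: "u0 \<in> A y0" "y0 + \<gamma> *\<^sub>R u0 = v" using minty[OF A \<gamma>] .
  have "(1 / \<gamma>) *\<^sub>R (v - y0) = u0" using y0(2) \<gamma> by auto
  hence y0R: "y0 \<in> ?R" using y0(1) mem by simp
  have uniq: "y = y'" if "y \<in> ?R" "y' \<in> ?R" for y y'
  proof -
    have "0 \<le> inner (y - y') ((1 / \<gamma>) *\<^sub>R (v - y) - (1 / \<gamma>) *\<^sub>R (v - y'))"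
      using that maximally_monotoneD[OF A] unfolding mem by blast
    also have "\<dots> = - (1 / \<gamma>) * (norm (y - y'))\<^sup>2"
      unfolding scaleR_diff_right[symmetric] power2_norm_eq_inner
      by (simp add: inner_diff_left inner_diff_right inner_commute algebra_simps)
    finally show ?thesis using \<gamma> by (simp add: divide_le_0_iff)
  qed
  have "?R = {y0}" using y0R uniq by blast
  hence "resolvent (scale_operator \<gamma> A) v = y0" by (simp add: resolvent_def)
  thus ?thesis using mem \<open>?R = {y0}\<close> by (metis singleton_iff)
qed

section \<open>The Tikhonov path of a nonexpansive map\<close>

lemma nonexpansive_displacement_monotone:
  fixes T :: "'a::real_inner \<Rightarrow> 'a"
  assumes T: "\<And>x y. norm (T x - T y) \<le> norm (x - y)"
  shows "0 \<le> inner ((u - T u) - (w - T w)) (u - w)"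
proof -
  have "inner (T u - T w) (u - w) \<le> norm (T u - T w) * norm (u - w)" by (rule norm_cauchy_schwarz)
  also have "\<dots> \<le> norm (u - w) * norm (u - w)" using T by (intro mult_right_mono) auto
  also have "\<dots> = inner (u - w) (u - w)" by (simp add: power2_norm_eq_inner flip: power2_eq_square)
  finally show ?thesis by (simp add: inner_diff_left)
qed

text \<open>Dividing by \<open>1 + \<epsilon>\<close> turns \<open>T\<close> into a strict contraction, to which Banach's theorem applies.\<close>

lemma tikhonov_point_exists:
  fixes T :: "'a::{real_inner, complete_space} \<Rightarrow> 'a"
  assumes T: "\<And>x y. norm (T x - T y) \<le> norm (x - y)" and e: "\<epsilon> > 0"
  obtains w where "T w = (1 + \<epsilon>) *\<^sub>R w"
proof -
  define c where "c = 1 / (1 + \<epsilon>)"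
  have c: "0 \<le> c" "c < 1" "(1 + \<epsilon>) * c = 1" using e by (auto simp: c_def field_simps)
  have "dist (c *\<^sub>R T x) (c *\<^sub>R T y) \<le> c * dist x y" for x y
    using T[of x y] c(1) by (simp add: dist_norm mult_left_mono flip: scaleR_diff_right)
  then obtain w where "c *\<^sub>R T w = w" using banach_fix_type[of c "\<lambda>x. c *\<^sub>R T x"] c by auto
  hence "(1 + \<epsilon>) *\<^sub>R w = (1 + \<epsilon>) *\<^sub>R c *\<^sub>R T w" by simp
  hence "T w = (1 + \<epsilon>) *\<^sub>R w" using c(3) by simp
  thus thesis by (rule that)
qed

text \<open>Along the path the displacement \<open>w - T w\<close> is \<open>- \<epsilon> w\<close>, so the monotonicity of \<open>Id - T\<close> reads
  \<open>\<langle>\<epsilon> w - \<delta> v, w - v\<rangle> \<le> 0\<close>. Expressing \<open>\<langle>w, v\<rangle>\<close> through norms gives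
  \<open>(\<epsilon> + \<delta>) \<parallel>w - v\<parallel>\<^sup>2 \<le> (\<epsilon> - \<delta>) (\<parallel>v\<parallel>\<^sup>2 - \<parallel>w\<parallel>\<^sup>2)\<close>. The case \<open>\<delta> = 0\<close> compares the path with
  a fixed point.\<close>

lemma tikhonov_path_gap:
  fixes T :: "'a::real_inner \<Rightarrow> 'a"
  assumes T: "\<And>x y. norm (T x - T y) \<le> norm (x - y)"
    and w: "T w = (1 + \<epsilon>) *\<^sub>R w" and v: "T v = (1 + \<delta>) *\<^sub>R v"
    and de: "0 \<le> \<delta>" "\<delta> < \<epsilon>"
  shows "(norm (w - v))\<^sup>2 \<le> (norm v)\<^sup>2 - (norm w)\<^sup>2"
proof -
  have "0 \<le> inner (\<delta> *\<^sub>R v - \<epsilon> *\<^sub>R w) (w - v)"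
    using nonexpansive_displacement_monotone[OF T, of w v] by (simp add: w v algebra_simps)
  hence 1: "\<epsilon> * inner w w + \<delta> * inner v v \<le> (\<epsilon> + \<delta>) * inner w v"
    by (simp add: inner_diff_left inner_diff_right inner_commute[of v w] algebra_simps)
  have 2: "(norm (w - v))\<^sup>2 = inner w w + inner v v - 2 * inner w v"
    by (simp add: power2_norm_eq_inner inner_diff_left inner_diff_right inner_commute[of v w])
  have "(\<epsilon> + \<delta>) * (norm (w - v))\<^sup>2
      = (\<epsilon> + \<delta>) * inner w w + (\<epsilon> + \<delta>) * inner v v - 2 * ((\<epsilon> + \<delta>) * inner w v)"
    unfolding 2 by (simp add: algebra_simps)
  also have "\<dots> \<le> (\<epsilon> - \<delta>) * (inner v v - inner w w)"
    using 1 by (simp add: algebra_simps)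
  finally have 3: "(\<epsilon> + \<delta>) * (norm (w - v))\<^sup>2 \<le> (\<epsilon> - \<delta>) * ((norm v)\<^sup>2 - (norm w)\<^sup>2)"
    by (simp add: power2_norm_eq_inner)
  have "0 \<le> (\<epsilon> + \<delta>) * (norm (w - v))\<^sup>2" using de by simp
  with 3 have "0 \<le> (\<epsilon> - \<delta>) * ((norm v)\<^sup>2 - (norm w)\<^sup>2)" by linarith
  hence "0 \<le> (norm v)\<^sup>2 - (norm w)\<^sup>2" using de by (simp add: zero_le_mult_iff)
  hence "(\<epsilon> - \<delta>) * ((norm v)\<^sup>2 - (norm w)\<^sup>2) \<le> (\<epsilon> + \<delta>) * ((norm v)\<^sup>2 - (norm w)\<^sup>2)"
    using de by (intro mult_right_mono) auto
  with 3 have "(\<epsilon> + \<delta>) * (norm (w - v))\<^sup>2 \<le> (\<epsilon> + \<delta>) * ((norm v)\<^sup>2 - (norm w)\<^sup>2)" by linarith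
  thus ?thesis using de by simp
qed

text \<open>By the previous estimate the norms increase along the path and are bounded by that of any
  fixed point; hence they converge, and the same estimate turns this into strong convergence of the
  points. The last conclusion makes \<open>p\<close> the unique fixed point of least norm.\<close>

lemma tikhonov_path_converges:
  fixes T :: "'a::{real_inner, complete_space} \<Rightarrow> 'a"
  assumes T: "\<And>x y. norm (T x - T y) \<le> norm (x - y)" and fix_ex: "T z0 = z0"
  obtains w p where "\<And>k. T (w k) = (1 + 1 / real (Suc k)) *\<^sub>R w k" "w \<longlonglongrightarrow> p" "T p = p"
    "\<And>z. T z = z \<Longrightarrow> (norm (p - z))\<^sup>2 \<le> (norm z)\<^sup>2 - (norm p)\<^sup>2"
proof -
  have "\<exists>w. T w = (1 + 1 / real (Suc k)) *\<^sub>R w" for k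
    using tikhonov_point_exists[OF T, of "1 / real (Suc k)"] by (metis divide_pos_pos of_nat_0_less_iff zero_less_Suc zero_less_one)
  then obtain w where w: "\<And>k. T (w k) = (1 + 1 / real (Suc k)) *\<^sub>R w k" by metis
  have wz: "(norm (w k - z))\<^sup>2 \<le> (norm z)\<^sup>2 - (norm (w k))\<^sup>2" if "T z = z" for k z
    using tikhonov_path_gap[OF T w, of z 0] that by simp
  have ww: "(norm (w k - w l))\<^sup>2 \<le> (norm (w l))\<^sup>2 - (norm (w k))\<^sup>2" if "k < l" for k l
    using tikhonov_path_gap[OF T w w, of l k] that by (simp add: frac_less2)
  define s where "s = (\<lambda>k. (norm (w k))\<^sup>2)"
  have s_mono: "s k \<le> s l" if "k \<le> l" for k l
  proof (cases "k = l")
    case False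
    hence "0 \<le> (norm (w l))\<^sup>2 - (norm (w k))\<^sup>2" using that ww[of k l] by (smt (verit) le_neq_implies_less zero_le_power2)
    thus ?thesis by (simp add: s_def)
  qed simp
  have "s k \<le> (norm z0)\<^sup>2" for k 
    using wz[OF fix_ex, of k] zero_le_power2[of "norm (w k - z0)"] unfolding s_def by linarith
  hence "convergent s" using s_mono by (intro Bseq_mono_convergent BseqI'[of _ "(norm z0)\<^sup>2"]) (auto simp: s_def)
  hence "Cauchy s" by (rule convergent_Cauchy)
  have "Cauchy w"
  proof (rule CauchyI)
    fix e :: real assume e: "e > 0"
    then obtain M where M: "\<And>i j. i \<ge> M \<Longrightarrow> j \<ge> M \<Longrightarrow> norm (s i - s j) < e\<^sup>2"
      using CauchyD[OF \<open>Cauchy s\<close>, of "e\<^sup>2"] by auto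
    have lt: "norm (w i - w j) < e" if "i \<ge> M" "j \<ge> M" "i < j" for i j
    proof -
      have "(norm (w i - w j))\<^sup>2 < e\<^sup>2" using ww[OF that(3)] M[OF that(1,2)] by (simp add: s_def)
      thus ?thesis using e power_less_imp_less_base by fastforce
    qed
    have "norm (w i - w j) < e" if "i \<ge> M" "j \<ge> M" for i j
      using lt[of i j] lt[of j i] that e by (cases i j rule: linorder_cases) (auto simp: norm_minus_commute)
    thus "\<exists>M. \<forall>i\<ge>M. \<forall>j\<ge>M. norm (w i - w j) < e" by blast
  qed
  then obtain p where p: "w \<longlonglongrightarrow> p" using Cauchy_convergent_iff convergent_def by blast
  have inv0: "(\<lambda>n. 1 / real (Suc n)) \<longlonglongrightarrow> 0" using LIMSEQ_inverse_real_of_nat by (simp add: inverse_eq_divide)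
  have "(\<lambda>k. T (w k) - T p) \<longlonglongrightarrow> 0"
  proof (rule Lim_null_comparison)
    show "\<forall>\<^sub>F k in sequentially. norm (T (w k) - T p) \<le> norm (w k - p)" using T by simp
    show "(\<lambda>k. norm (w k - p)) \<longlonglongrightarrow> 0" using p by (simp add: LIM_zero tendsto_norm_zero)
  qed
  hence "(\<lambda>k. T (w k)) \<longlonglongrightarrow> T p" by (simp add: LIM_zero_cancel)
  moreover have "(\<lambda>k. T (w k)) \<longlonglongrightarrow> (1 + 0) *\<^sub>R p" unfolding w by (intro tendsto_intros inv0 p)
  ultimately have Tp: "T p = p" using LIMSEQ_unique by fastforce
  have min: "(norm (p - z))\<^sup>2 \<le> (norm z)\<^sup>2 - (norm p)\<^sup>2" if "T z = z" for z
  proof (rule LIMSEQ_le)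
    show "(\<lambda>k. (norm (w k - z))\<^sup>2) \<longlonglongrightarrow> (norm (p - z))\<^sup>2" by (intro tendsto_intros p)
    show "(\<lambda>k. (norm z)\<^sup>2 - (norm (w k))\<^sup>2) \<longlonglongrightarrow> (norm z)\<^sup>2 - (norm p)\<^sup>2" by (intro tendsto_intros p)
  qed (use wz that in blast)
  show thesis using that w p Tp min by blast
qed

lemma projection_0_eqI:
  fixes p :: "'a::real_inner"
  assumes "p \<in> C" and min: "\<And>z. z \<in> C \<Longrightarrow> (norm (p - z))\<^sup>2 \<le> (norm z)\<^sup>2 - (norm p)\<^sup>2"
  shows "projection C 0 = p"
  unfolding projection_def arg_min_on_def
proof (rule arg_minI)
  show "p \<in> C" by fact
  fix z assume z: "z \<in> C"
  have "(norm p)\<^sup>2 \<le> (norm z)\<^sup>2" using min[OF z] zero_le_power2[of "norm (p - z)"] by linarith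
  hence "norm p \<le> norm z" by (rule power2_le_imp_le) simp
  thus "\<not> norm (0 - z) < norm (0 - p)" by simp
next
  fix z assume z: "z \<in> C" "\<forall>y. y \<in> C \<longrightarrow> \<not> norm (0 - y) < norm (0 - z)"
  hence "norm z \<le> norm p" using \<open>p \<in> C\<close> by (simp add: not_less)
  hence "(norm z)\<^sup>2 \<le> (norm p)\<^sup>2" by (simp add: power_mono)
  hence "(norm (p - z))\<^sup>2 \<le> 0" using min[OF z(1)] by linarith
  thus "z = p" by simp
qed

text \<open>Monotonicity of \<open>Id - T\<close> at \<open>u\<^sub>n\<close> and a path point \<open>w\<close> with parameter \<open>\<epsilon>\<close> gives
  \<open>0 \<le> \<langle>u\<^sub>n - T u\<^sub>n, u\<^sub>n - w\<rangle> + \<epsilon> \<langle>w, u\<^sub>n - w\<rangle>\<close>, where the first term vanishes as \<open>n \<rightarrow> \<infinity>\<close> with \<open>w\<close> fixed.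
  Because \<open>u\<close> is bounded, replacing \<open>w\<close> by \<open>p\<close> costs an error uniform in \<open>n\<close>, so \<open>w\<close> can be chosen
  close to \<open>p\<close> beforehand. This takes the place of a weak compactness argument.\<close>

lemma asymptotic_fixed_points_half_space:
  fixes T :: "'a::real_inner \<Rightarrow> 'a" and u :: "nat \<Rightarrow> 'a"
  assumes T: "\<And>x y. norm (T x - T y) \<le> norm (x - y)"
    and w: "\<And>k. T (w k) = (1 + 1 / real (Suc k)) *\<^sub>R w k" and p: "w \<longlonglongrightarrow> p"
    and R: "\<And>n. norm (u n) \<le> R" and reg: "(\<lambda>n. u n - T (u n)) \<longlonglongrightarrow> 0" and e: "e > 0"
  shows "\<forall>\<^sub>F n in sequentially. - e \<le> inner p (u n - p)"
proof -
  have R0: "R \<ge> 0" using R[of 0] norm_ge_zero order_trans by blast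
  have "(\<lambda>k. norm (p - w k) * R + \<bar>(norm (w k))\<^sup>2 - (norm p)\<^sup>2\<bar>)
      \<longlonglongrightarrow> norm (p - p) * R + \<bar>(norm p)\<^sup>2 - (norm p)\<^sup>2\<bar>"
    by (intro tendsto_intros p)
  hence "(\<lambda>k. norm (p - w k) * R + \<bar>(norm (w k))\<^sup>2 - (norm p)\<^sup>2\<bar>) \<longlonglongrightarrow> 0" by simp
  hence "\<forall>\<^sub>F k in sequentially. norm (p - w k) * R + \<bar>(norm (w k))\<^sup>2 - (norm p)\<^sup>2\<bar> < e / 2"
    using e by (intro order_tendstoD(2)) auto
  then obtain k where k: "norm (p - w k) * R + \<bar>(norm (w k))\<^sup>2 - (norm p)\<^sup>2\<bar> < e / 2"
    by (auto simp: eventually_sequentially)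
  define \<epsilon> where "\<epsilon> = 1 / real (Suc k)"
  have eps: "\<epsilon> > 0" by (simp add: \<epsilon>_def)
  have low: "- (norm (u n - T (u n)) * (R + norm (w k)) / \<epsilon>) \<le> inner (w k) (u n - w k)" for n
  proof -
    have "0 \<le> inner ((u n - T (u n)) + \<epsilon> *\<^sub>R w k) (u n - w k)"
      using nonexpansive_displacement_monotone[OF T, of "u n" "w k"]
      by (simp add: w \<epsilon>_def algebra_simps)
    hence "0 \<le> inner (u n - T (u n)) (u n - w k) + \<epsilon> * inner (w k) (u n - w k)"
      by (simp add: inner_add_left)
    also have "inner (u n - T (u n)) (u n - w k) \<le> norm (u n - T (u n)) * norm (u n - w k)"
      by (rule norm_cauchy_schwarz)
    also have "\<dots> \<le> norm (u n - T (u n)) * (R + norm (w k))"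
      using norm_triangle_ineq4[of "u n" "w k"] R[of n] by (intro mult_left_mono) auto
    finally show ?thesis using eps by (simp add: field_simps)
  qed
  have close: "inner (w k) (u n - w k) - e / 2 \<le> inner p (u n - p)" for n
  proof -
    have "inner (w k) (u n - w k) - inner p (u n - p) = - inner (p - w k) (u n) + ((norm p)\<^sup>2 - (norm (w k))\<^sup>2)"
      by (simp add: power2_norm_eq_inner inner_diff_left inner_diff_right)
    moreover have "\<bar>inner (p - w k) (u n)\<bar> \<le> norm (p - w k) * R"
      using Cauchy_Schwarz_ineq2[of "p - w k" "u n"] mult_left_mono[OF R[of n], of "norm (p - w k)"] by simp
    ultimately show ?thesis using k by linarith
  qed
  have "(\<lambda>n. norm (u n - T (u n)) * (R + norm (w k)) / \<epsilon>) \<longlonglongrightarrow> norm (0::'a) * (R + norm (w k)) / \<epsilon>"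
    using eps by (intro tendsto_intros reg) auto
  hence "\<forall>\<^sub>F n in sequentially. norm (u n - T (u n)) * (R + norm (w k)) / \<epsilon> < e / 2"
    using e by (intro order_tendstoD(2)) auto
  thus ?thesis
  proof eventually_elim
    case (elim n)
    show ?case using elim low[of n] close[of n] by linarith
  qed
qed

section \<open>The forward-backward map\<close>

definition forward_backward :: "real \<Rightarrow> ('a::real_vector \<Rightarrow> 'a set) \<Rightarrow> ('a \<Rightarrow> 'a) \<Rightarrow> 'a \<Rightarrow> 'a" where
  "forward_backward \<gamma> A B u = resolvent (scale_operator \<gamma> A) (u - \<gamma> *\<^sub>R B u)"

lemma forward_backward_iff:
  fixes A :: "'a::{real_inner, complete_space} \<Rightarrow> 'a set"
  assumes "maximally_monotone A" "\<gamma> > 0"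
  shows "forward_backward \<gamma> A B u = y \<longleftrightarrow> (1 / \<gamma>) *\<^sub>R (u - y) - B u \<in> A y"
proof -
  have "(1 / \<gamma>) *\<^sub>R (u - \<gamma> *\<^sub>R B u - y) = (1 / \<gamma>) *\<^sub>R (u - y) - B u"
    using assms(2) by (simp add: scaleR_diff_right)
  thus ?thesis using resolvent_scale_iff[OF assms] by (simp add: forward_backward_def)
qed

lemma forward_backward_mem:
  fixes A :: "'a::{real_inner, complete_space} \<Rightarrow> 'a set"
  assumes "maximally_monotone A" "\<gamma> > 0"
  shows "(1 / \<gamma>) *\<^sub>R (u - forward_backward \<gamma> A B u) - B u \<in> A (forward_backward \<gamma> A B u)"
  using forward_backward_iff[OF assms] by metis

lemma forward_backward_fixed_iff:
  fixes A :: "'a::{real_inner, complete_space} \<Rightarrow> 'a set"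
  assumes "maximally_monotone A" "\<gamma> > 0"
  shows "forward_backward \<gamma> A B z = z \<longleftrightarrow> z \<in> zeros (\<lambda>z. A z + {B z})"
proof -
  have "z \<in> zeros (\<lambda>z. A z + {B z}) \<longleftrightarrow> (\<exists>a\<in>A z. 0 = a + B z)"
    by (auto simp: zeros_def set_plus_def)
  also have "\<dots> \<longleftrightarrow> - B z \<in> A z"
    by (auto simp: eq_neg_iff_add_eq_0[symmetric] eq_commute[of 0])
  finally show ?thesis using assms by (simp add: forward_backward_iff)
qed

text \<open>With \<open>d = u - v\<close> and \<open>r\<close> the difference of the two displacements, the difference of the relaxed
  images is \<open>d - \<kappa> r\<close>, so it suffices that \<open>\<kappa> \<parallel>r\<parallel>\<^sup>2 \<le> 2 \<langle>d, r\<rangle>\<close>. Monotonicity of \<open>A\<close> gives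
  \<open>\<langle>d, r\<rangle> \<ge> \<parallel>r\<parallel>\<^sup>2 + \<gamma> \<langle>d, g\<rangle> - \<gamma> \<langle>r, g\<rangle>\<close> with \<open>g = B u - B v\<close>, and cocoercivity of \<open>B\<close> supplies the multiple
  of \<open>\<parallel>g\<parallel>\<^sup>2\<close> that absorbs \<open>\<langle>r, g\<rangle>\<close>, leaving \<open>(1 - \<gamma> / (4 \<beta>)) \<parallel>r\<parallel>\<^sup>2\<close>. The upper bound on \<open>\<kappa>\<close> is twice
  this factor.\<close>

lemma relaxed_forward_backward_nonexpansive:
  fixes A :: "'a::{real_inner, complete_space} \<Rightarrow> 'a set"
  assumes A: "maximally_monotone A" and B: "cocoercive \<beta> B" "\<beta> > 0" and \<gamma>: "\<gamma> > 0"
    and lam: "0 \<le> \<kappa>" "\<kappa> \<le> (4 * \<beta> - \<gamma>) / (2 * \<beta>)"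
  defines "T \<equiv> forward_backward \<gamma> A B"
  shows "norm (((1 - \<kappa>) *\<^sub>R u + \<kappa> *\<^sub>R T u) - ((1 - \<kappa>) *\<^sub>R v + \<kappa> *\<^sub>R T v)) \<le> norm (u - v)"
proof -
  define d where "d = u - v"
  define r where "r = (u - T u) - (v - T v)"
  define g where "g = B u - B v"
  have mem: "(1 / \<gamma>) *\<^sub>R (u - T u) - B u \<in> A (T u)" for u
    unfolding T_def by (rule forward_backward_mem[OF A \<gamma>])
  have "0 \<le> inner (T u - T v) (((1 / \<gamma>) *\<^sub>R (u - T u) - B u) - ((1 / \<gamma>) *\<^sub>R (v - T v) - B v))"
    by (rule maximally_monotoneD[OF A mem mem])
  also have "T u - T v = d - r" by (simp add: d_def r_def)
  also have "((1 / \<gamma>) *\<^sub>R (u - T u) - B u) - ((1 / \<gamma>) *\<^sub>R (v - T v) - B v) = (1 / \<gamma>) *\<^sub>R r - g"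
    by (simp add: r_def g_def algebra_simps)
  finally have "0 \<le> \<gamma> * inner (d - r) ((1 / \<gamma>) *\<^sub>R r - g)" using \<gamma> by simp
  hence 1: "(norm r)\<^sup>2 + \<gamma> * inner d g - \<gamma> * inner r g \<le> inner d r"
    using \<gamma> by (simp add: inner_diff_left inner_diff_right power2_norm_eq_inner algebra_simps)
  have 2: "\<gamma> * (\<beta> * (norm g)\<^sup>2) \<le> \<gamma> * inner d g"
    using B(1) \<gamma> unfolding cocoercive_def d_def g_def by (intro mult_left_mono) auto
  have 3: "inner r g \<le> \<beta> * (norm g)\<^sup>2 + (norm r)\<^sup>2 / (4 * \<beta>)"
  proof -
    have "0 \<le> (norm (r - (2 * \<beta>) *\<^sub>R g))\<^sup>2" by simp
    also have "\<dots> = (norm r)\<^sup>2 - 4 * \<beta> * inner r g + 4 * \<beta> * (\<beta> * (norm g)\<^sup>2)"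
      by (simp add: power2_norm_eq_inner inner_diff_left inner_diff_right inner_commute[of g r] algebra_simps)
    finally show ?thesis using B(2) by (simp add: field_simps)
  qed
  have "\<gamma> * inner r g \<le> \<gamma> * (\<beta> * (norm g)\<^sup>2) + \<gamma> * ((norm r)\<^sup>2 / (4 * \<beta>))"
    using mult_left_mono[OF 3, of \<gamma>] \<gamma> by (simp add: distrib_left)
  with 1 2 have "(norm r)\<^sup>2 - \<gamma> * ((norm r)\<^sup>2 / (4 * \<beta>)) \<le> inner d r" by linarith
  hence "((4 * \<beta> - \<gamma>) / (2 * \<beta>)) * (norm r)\<^sup>2 \<le> 2 * inner d r"
    using B(2) by (simp add: field_simps)
  moreover have "\<kappa> * (norm r)\<^sup>2 \<le> ((4 * \<beta> - \<gamma>) / (2 * \<beta>)) * (norm r)\<^sup>2"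
    using lam by (intro mult_right_mono) auto
  ultimately have "\<kappa> * (norm r)\<^sup>2 \<le> 2 * inner d r" by linarith
  hence 4: "\<kappa> * (\<kappa> * (norm r)\<^sup>2) \<le> \<kappa> * (2 * inner d r)" using lam by (intro mult_left_mono)
  have "(norm (d - \<kappa> *\<^sub>R r))\<^sup>2 = (norm d)\<^sup>2 - \<kappa> * (2 * inner d r) + \<kappa> * (\<kappa> * (norm r)\<^sup>2)"
    by (simp add: power2_norm_eq_inner inner_diff_left inner_diff_right inner_commute[of r d] algebra_simps)
  with 4 have "(norm (d - \<kappa> *\<^sub>R r))\<^sup>2 \<le> (norm d)\<^sup>2" by linarith
  hence "norm (d - \<kappa> *\<^sub>R r) \<le> norm d" by (rule power2_le_imp_le) simp
  moreover have "((1 - \<kappa>) *\<^sub>R u + \<kappa> *\<^sub>R T u) - ((1 - \<kappa>) *\<^sub>R v + \<kappa> *\<^sub>R T v) = d - \<kappa> *\<^sub>R r"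
    by (simp add: d_def r_def algebra_simps)
  ultimately show ?thesis by (simp add: d_def)
qed

text \<open>The step size \<open>2 \<beta>\<close> is included because the limit of the step sizes of the scheme may attain it.\<close>

lemma forward_backward_nonexpansive:
  fixes A :: "'a::{real_inner, complete_space} \<Rightarrow> 'a set"
  assumes A: "maximally_monotone A" and B: "cocoercive \<beta> B" "\<beta> > 0" and \<gamma>: "0 < \<gamma>" "\<gamma> \<le> 2 * \<beta>"
  shows "norm (forward_backward \<gamma> A B u - forward_backward \<gamma> A B v) \<le> norm (u - v)"
  using relaxed_forward_backward_nonexpansive[OF A B \<gamma>(1), of 1 u v] B(2) \<gamma> by (simp add: field_simps)

text \<open>The two images satisfy inclusions in which \<open>B u\<close> occurs identically and hence cancels when \<open>A\<close> is
  tested on them. The change is therefore controlled by the displacement of \<open>u\<close> alone.\<close>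

lemma forward_backward_step_size_change:
  fixes A :: "'a::{real_inner, complete_space} \<Rightarrow> 'a set"
  assumes A: "maximally_monotone A" and \<gamma>: "\<gamma> > 0" and \<gamma>': "\<gamma>' > 0"
  shows "norm (forward_backward \<gamma> A B u - forward_backward \<gamma>' A B u)
    \<le> \<bar>\<gamma> - \<gamma>'\<bar> / \<gamma> * norm (u - forward_backward \<gamma> A B u)"
proof -
  define y where "y = forward_backward \<gamma> A B u"
  define y' where "y' = forward_backward \<gamma>' A B u"
  define d where "d = y - y'"
  have "(1 / \<gamma>) *\<^sub>R (u - y) - B u \<in> A y" "(1 / \<gamma>') *\<^sub>R (u - y') - B u \<in> A y'"
    unfolding y_def y'_def by (rule forward_backward_mem[OF A \<gamma>] forward_backward_mem[OF A \<gamma>'])+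
  from maximally_monotoneD[OF A this]
  have "0 \<le> \<gamma>' * inner d ((1 / \<gamma>) *\<^sub>R (u - y) - (1 / \<gamma>') *\<^sub>R (u - y'))"
    using \<gamma>' by (simp add: d_def)
  also have "(1 / \<gamma>) *\<^sub>R (u - y) - (1 / \<gamma>') *\<^sub>R (u - y') = (1 / \<gamma> - 1 / \<gamma>') *\<^sub>R (u - y) - (1 / \<gamma>') *\<^sub>R d"
    by (simp add: d_def algebra_simps)
  also have "\<gamma>' * inner d \<dots> = \<gamma>' * ((1 / \<gamma> - 1 / \<gamma>') * inner d (u - y) - (1 / \<gamma>') * inner d d)"
    by (simp only: inner_diff_right[of d "(1 / \<gamma> - 1 / \<gamma>') *\<^sub>R (u - y)"] inner_scaleR_right)
  also have "\<dots> = ((\<gamma>' - \<gamma>) / \<gamma>) * inner d (u - y) - (norm d)\<^sup>2"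
    using \<gamma> \<gamma>' unfolding power2_norm_eq_inner by (simp add: divide_simps del: inner_diff_right)
  finally have "(norm d)\<^sup>2 \<le> ((\<gamma>' - \<gamma>) / \<gamma>) * inner d (u - y)" by simp
  also have "\<dots> \<le> \<bar>((\<gamma>' - \<gamma>) / \<gamma>) * inner d (u - y)\<bar>" by (rule abs_ge_self)
  also have "\<dots> = (\<bar>\<gamma> - \<gamma>'\<bar> / \<gamma>) * \<bar>inner d (u - y)\<bar>"
    using \<gamma> by (simp add: abs_mult abs_minus_commute)
  also have "\<dots> \<le> (\<bar>\<gamma> - \<gamma>'\<bar> / \<gamma>) * (norm d * norm (u - y))"
    using \<gamma> by (intro mult_left_mono Cauchy_Schwarz_ineq2) auto
  finally have "norm d * norm d \<le> norm d * (\<bar>\<gamma> - \<gamma>'\<bar> / \<gamma> * norm (u - y))"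
    by (simp add: power2_eq_square mult_ac)
  hence "norm d \<le> \<bar>\<gamma> - \<gamma>'\<bar> / \<gamma> * norm (u - y)"
    using \<gamma> by (cases "d = 0") (simp_all add: mult_le_cancel_left_pos del: times_divide_eq_left)
  thus ?thesis by (simp add: d_def y_def y'_def)
qed

section \<open>Strong convergence of the scheme\<close>

text \<open>Both bounds come from \<open>b x - p = b (x - p) - (1 - b) p\<close>. The first, a convex combination, keeps the
  iterates bounded; the second is the recursive inequality that decides the convergence.\<close>

lemma tikhonov_step_norm:
  fixes x p :: "'a::real_inner"
  assumes "0 \<le> b" "b \<le> 1"
  shows "norm (b *\<^sub>R x - p) \<le> b * norm (x - p) + (1 - b) * norm p"
    and "(norm (b *\<^sub>R x - p))\<^sup>2 \<le> b * (norm (x - p))\<^sup>2 - 2 * (1 - b) * inner p (b *\<^sub>R x - p)"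
proof -
  have split: "b *\<^sub>R x - p = b *\<^sub>R (x - p) - (1 - b) *\<^sub>R p" by (simp add: algebra_simps)
  have "norm (b *\<^sub>R x - p) \<le> norm (b *\<^sub>R (x - p)) + norm ((1 - b) *\<^sub>R p)"
    unfolding split by (rule norm_triangle_ineq4)
  thus "norm (b *\<^sub>R x - p) \<le> b * norm (x - p) + (1 - b) * norm p" using assms by simp
  have "b *\<^sub>R (x - p) = (b *\<^sub>R x - p) + (1 - b) *\<^sub>R p" by (simp add: split)
  moreover have "(norm (c + s *\<^sub>R p))\<^sup>2 = (norm c)\<^sup>2 + 2 * s * inner p c + (s * norm p)\<^sup>2" for c s
    unfolding power2_norm_eq_inner power_mult_distrib
    by (simp add: inner_add_left inner_add_right inner_commute[of c p] power2_eq_square algebra_simps)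
  ultimately have "(norm (b *\<^sub>R (x - p)))\<^sup>2
      = (norm (b *\<^sub>R x - p))\<^sup>2 + 2 * (1 - b) * inner p (b *\<^sub>R x - p) + ((1 - b) * norm p)\<^sup>2"
    by (simp only:)
  hence "(norm (b *\<^sub>R x - p))\<^sup>2 \<le> (norm (b *\<^sub>R (x - p)))\<^sup>2 - 2 * (1 - b) * inner p (b *\<^sub>R x - p)"
    by (smt (verit) zero_le_power2)
  moreover have "(norm (b *\<^sub>R (x - p)))\<^sup>2 \<le> b * (norm (x - p))\<^sup>2"
  proof -
    have "b\<^sup>2 \<le> b" using assms by (simp add: power2_eq_square mult_left_le)
    thus ?thesis by (simp add: power_mult_distrib mult_right_mono)
  qed
  ultimately show "(norm (b *\<^sub>R x - p))\<^sup>2 \<le> b * (norm (x - p))\<^sup>2 - 2 * (1 - b) * inner p (b *\<^sub>R x - p)"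
    by linarith
qed

text \<open>Consecutive steps compare as \<open>\<parallel>x\<^sub>n\<^sub>+\<^sub>2 - x\<^sub>n\<^sub>+\<^sub>1\<parallel> \<le> \<parallel>u\<^sub>n\<^sub>+\<^sub>1 - u\<^sub>n\<parallel> + \<parallel>S\<^sub>n\<^sub>+\<^sub>1 u\<^sub>n - S\<^sub>n u\<^sub>n\<parallel>\<close>. The first term is
  at most \<open>\<beta>\<^sub>n\<^sub>+\<^sub>1\<close> times the previous step plus \<open>R \<bar>\<beta>\<^sub>n\<^sub>+\<^sub>1 - \<beta>\<^sub>n\<bar>\<close>; the second is of the order of the
  variations of \<open>\<lambda>\<close> and \<open>\<gamma>\<close>, because \<open>D\<close> bounds the displacements and \<open>C\<close> the inverse
  step sizes.\<close>

lemma asymptotic_regularity: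
  fixes A :: "'a::{real_inner, complete_space} \<Rightarrow> 'a set" and B :: "'a \<Rightarrow> 'a"
    and x :: "nat \<Rightarrow> 'a" and lam b \<gamma> :: "nat \<Rightarrow> real"
  defines "T \<equiv> \<lambda>n. forward_backward (\<gamma> n) A B"
  assumes A: "maximally_monotone A" and B: "cocoercive \<beta> B" "\<beta> > 0"
    and scheme: "\<And>n. x (Suc n) = (1 - lam n) *\<^sub>R (b n *\<^sub>R x n) + lam n *\<^sub>R T n (b n *\<^sub>R x n)"
    and b: "\<And>n. 0 < b n \<and> b n \<le> 1"
    and b_div: "filterlim (\<lambda>N. \<Sum>n<N. 1 - b n) at_top sequentially"
    and b_var: "summable (\<lambda>n. \<bar>b (Suc n) - b n\<bar>)"
    and lam: "\<And>n. 0 < lam n \<and> lam n \<le> (4 * \<beta> - \<gamma> n) / (2 * \<beta>)"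
    and lam_var: "summable (\<lambda>n. \<bar>lam (Suc n) - lam n\<bar>)"
    and \<gamma>: "\<And>n. 0 < \<gamma> n" and \<gamma>_inv: "\<And>n. 1 / \<gamma> n \<le> C"
    and \<gamma>_var: "summable (\<lambda>n. \<bar>\<gamma> (Suc n) - \<gamma> n\<bar>)"
    and R: "\<And>n. norm (x n) \<le> R"
    and D: "\<And>m n. norm (b n *\<^sub>R x n - T m (b n *\<^sub>R x n)) \<le> D"
  shows "(\<lambda>n. x (Suc n) - x n) \<longlonglongrightarrow> 0"
proof -
  define u where "u = (\<lambda>n. b n *\<^sub>R x n)"
  define S where "S = (\<lambda>n v. (1 - lam n) *\<^sub>R v + lam n *\<^sub>R T n v)"
  define \<eta> where "\<eta> = (\<lambda>n. R * \<bar>b (Suc n) - b n\<bar> + (D * \<bar>lam (Suc n) - lam n\<bar>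
      + 2 * (C * D * \<bar>\<gamma> (Suc n) - \<gamma> n\<bar>)))"
  have D': "norm (u n - T m (u n)) \<le> D" for m n using D by (simp add: u_def)
  have D0: "D \<ge> 0" using D' norm_ge_zero order_trans by blast
  have R0: "R \<ge> 0" using R norm_ge_zero order_trans by blast
  have C0: "C \<ge> 0" using \<gamma>_inv[of 0] \<gamma>[of 0] by (smt (verit) divide_pos_pos)
  have lam2: "lam n \<le> 2" for n
  proof -
    have "(4 * \<beta> - \<gamma> n) / (2 * \<beta>) \<le> 2" using \<gamma>[of n] B(2) by (simp add: field_simps)
    thus ?thesis using lam[of n] by linarith
  qed
  have x_S: "x (Suc n) = S n (u n)" for n using scheme by (simp add: S_def u_def)
  have S_nonexp: "norm (S n v - S n v') \<le> norm (v - v')" for n v v'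
    using relaxed_forward_backward_nonexpansive[OF A B, of "\<gamma> n" "lam n" v v'] \<gamma> lam[of n]
    by (simp add: S_def T_def)
  have u_diff: "norm (u (Suc n) - u n) \<le> b (Suc n) * norm (x (Suc n) - x n) + R * \<bar>b (Suc n) - b n\<bar>" for n
  proof -
    have "u (Suc n) - u n = b (Suc n) *\<^sub>R (x (Suc n) - x n) + (b (Suc n) - b n) *\<^sub>R x n"
      by (simp add: u_def algebra_simps)
    hence "norm (u (Suc n) - u n) \<le> norm (b (Suc n) *\<^sub>R (x (Suc n) - x n)) + norm ((b (Suc n) - b n) *\<^sub>R x n)"
      by (metis norm_triangle_ineq)
    also have "\<dots> \<le> b (Suc n) * norm (x (Suc n) - x n) + R * \<bar>b (Suc n) - b n\<bar>"
      using b[of "Suc n"] mult_right_mono[OF R[of n], of "\<bar>b (Suc n) - b n\<bar>"] by (simp add: mult.commute)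
    finally show ?thesis .
  qed
  have T_diff: "norm (T (Suc n) (u n) - T n (u n)) \<le> C * D * \<bar>\<gamma> (Suc n) - \<gamma> n\<bar>" for n
  proof -
    have "norm (T (Suc n) (u n) - T n (u n))
        \<le> \<bar>\<gamma> (Suc n) - \<gamma> n\<bar> / \<gamma> (Suc n) * norm (u n - T (Suc n) (u n))"
      unfolding T_def by (rule forward_backward_step_size_change[OF A \<gamma> \<gamma>])
    also have "\<dots> = \<bar>\<gamma> (Suc n) - \<gamma> n\<bar> * (1 / \<gamma> (Suc n) * norm (u n - T (Suc n) (u n)))" by simp
    also have "\<dots> \<le> \<bar>\<gamma> (Suc n) - \<gamma> n\<bar> * (C * D)"
      using D' \<gamma>_inv C0 by (intro mult_left_mono mult_mono) auto
    finally show ?thesis by (simp add: mult_ac)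
  qed
  have S_diff: "norm (S (Suc n) (u n) - S n (u n))
      \<le> D * \<bar>lam (Suc n) - lam n\<bar> + 2 * (C * D * \<bar>\<gamma> (Suc n) - \<gamma> n\<bar>)" for n
  proof -
    have "S (Suc n) (u n) - S n (u n)
        = (lam n - lam (Suc n)) *\<^sub>R (u n - T (Suc n) (u n)) + lam n *\<^sub>R (T (Suc n) (u n) - T n (u n))"
      by (simp add: S_def algebra_simps)
    hence "norm (S (Suc n) (u n) - S n (u n))
        \<le> norm ((lam n - lam (Suc n)) *\<^sub>R (u n - T (Suc n) (u n))) + norm (lam n *\<^sub>R (T (Suc n) (u n) - T n (u n)))"
      by (metis norm_triangle_ineq)
    also have "\<dots> \<le> \<bar>lam (Suc n) - lam n\<bar> * D + 2 * (C * D * \<bar>\<gamma> (Suc n) - \<gamma> n\<bar>)"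
    proof (intro add_mono)
      show "norm ((lam n - lam (Suc n)) *\<^sub>R (u n - T (Suc n) (u n))) \<le> \<bar>lam (Suc n) - lam n\<bar> * D"
        using mult_left_mono[OF D'[of n "Suc n"], of "\<bar>lam (Suc n) - lam n\<bar>"] by (simp add: abs_minus_commute)
      have "lam n * norm (T (Suc n) (u n) - T n (u n)) \<le> 2 * (C * D * \<bar>\<gamma> (Suc n) - \<gamma> n\<bar>)"
        by (rule mult_mono[OF lam2 T_diff]) auto
      thus "norm (lam n *\<^sub>R (T (Suc n) (u n) - T n (u n))) \<le> 2 * (C * D * \<bar>\<gamma> (Suc n) - \<gamma> n\<bar>)"
        using lam[of n] by simp
    qed
    finally show ?thesis by (simp add: mult.commute)
  qed
  have "(\<lambda>n. norm (x (Suc n) - x n)) \<longlonglongrightarrow> 0"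
  proof (rule perturbed_recursion_tendsto_0[where \<theta> = "\<lambda>n. 1 - b (Suc n)" and \<delta> = "\<lambda>_. 0" and \<eta> = \<eta>])
    show "0 \<le> 1 - b (Suc n) \<and> 1 - b (Suc n) \<le> 1" for n using b[of "Suc n"] by simp
    show "filterlim (\<lambda>N. \<Sum>n<N. 1 - b (Suc n)) at_top sequentially"
      using sum_at_top_shift[OF b_div, of 1] by simp
    show "0 \<le> \<eta> n" for n unfolding \<eta>_def using R0 C0 D0 by simp
    show "summable \<eta>" unfolding \<eta>_def
      by (intro summable_add summable_mult b_var lam_var \<gamma>_var)
    fix n
    have "x (Suc (Suc n)) - x (Suc n) = (S (Suc n) (u (Suc n)) - S (Suc n) (u n)) + (S (Suc n) (u n) - S n (u n))"
      by (simp add: x_S)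
    hence "norm (x (Suc (Suc n)) - x (Suc n))
        \<le> norm (S (Suc n) (u (Suc n)) - S (Suc n) (u n)) + norm (S (Suc n) (u n) - S n (u n))"
      by (metis norm_triangle_ineq)
    also have "\<dots> \<le> b (Suc n) * norm (x (Suc n) - x n) + \<eta> n"
      using S_nonexp[of "Suc n" "u (Suc n)" "u n"] u_diff[of n] S_diff[of n] by (simp add: \<eta>_def)
    finally show "norm (x (Suc (Suc n)) - x (Suc n))
        \<le> (1 - (1 - b (Suc n))) * norm (x (Suc n) - x n) + (1 - b (Suc n)) * 0 + \<eta> n" by simp
  qed auto
  thus ?thesis by (rule tendsto_norm_zero_cancel)
qed

theorem theorem2:
  fixes A :: "'a::{real_inner, complete_space} \<Rightarrow> 'a set"
    and B :: "'a \<Rightarrow> 'a"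
    and \<beta> :: real
    and x :: "nat \<Rightarrow> 'a"
    and lam b \<gamma> :: "nat \<Rightarrow> real"
  assumes "maximally_monotone A"
    and "\<beta> > 0"
    and "cocoercive \<beta> B"
    and "zeros (\<lambda>z. A z + {B z}) \<noteq> {}"
    and scheme: "\<And>n. x (Suc n) =
          ((1 - lam n) * b n) *\<^sub>R x n
          + lam n *\<^sub>R resolvent (scale_operator (\<gamma> n) A) (b n *\<^sub>R x n - \<gamma> n *\<^sub>R B (b n *\<^sub>R x n))"
    and "\<And>n. 0 < b n \<and> b n \<le> 1"
    and "b \<longlonglongrightarrow> 1"
    and "filterlim (\<lambda>N. \<Sum>n<N. 1 - b n) at_top sequentially"
    and "summable (\<lambda>n. \<bar>b (Suc n) - b n\<bar>)"
    and "\<And>n. 0 < lam n \<and> lam n \<le> (4 * \<beta> - \<gamma> n) / (2 * \<beta>)"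
    and "liminf (\<lambda>n. ereal (lam n)) > 0"
    and "summable (\<lambda>n. \<bar>lam (Suc n) - lam n\<bar>)"
    and "\<And>n. 0 < \<gamma> n \<and> \<gamma> n < 2 * \<beta>"
    and "liminf (\<lambda>n. ereal (\<gamma> n)) > 0"
    and "summable (\<lambda>n. \<bar>\<gamma> (Suc n) - \<gamma> n\<bar>)"
  shows "x \<longlonglongrightarrow> projection (zeros (\<lambda>z. A z + {B z})) 0"
proof -
  note A = assms(1) and B = assms(3,2) and b = assms(6) and b_lim = assms(7) and b_div = assms(8)
    and lam = assms(10)
  have \<gamma>: "0 < \<gamma> n" "\<gamma> n \<le> 2 * \<beta>" for n using assms(13)[of n] by auto
  define T where "T = (\<lambda>n. forward_backward (\<gamma> n) A B)"
  define u where "u = (\<lambda>n. b n *\<^sub>R x n)"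
  have x_Suc: "x (Suc n) = (1 - lam n) *\<^sub>R u n + lam n *\<^sub>R T n (u n)" for n
    using scheme[of n] by (simp add: u_def T_def forward_backward_def)

  obtain g where g: "\<gamma> \<longlonglongrightarrow> g" "g > 0" using bounded_variation_pos_limit assms(14,15) by blast
  obtain l where l: "lam \<longlonglongrightarrow> l" "l > 0" using bounded_variation_pos_limit assms(11,12) by blast
  have g_le: "g \<le> 2 * \<beta>" using g(1) \<gamma> by (intro tendsto_upperbound[of \<gamma>]) auto
  define Tg where "Tg = forward_backward g A B"
  have Tg_nonexp: "norm (Tg v - Tg v') \<le> norm (v - v')" for v v'
    unfolding Tg_def by (rule forward_backward_nonexpansive[OF A B g(2) g_le])
  have T_nonexp: "norm (T n v - T n v') \<le> norm (v - v')" for n v v'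
    unfolding T_def by (rule forward_backward_nonexpansive[OF A B \<gamma>])
  have Tg_fix: "Tg z = z \<longleftrightarrow> z \<in> zeros (\<lambda>z. A z + {B z})" for z
    unfolding Tg_def by (rule forward_backward_fixed_iff[OF A g(2)])
  have T_fix: "T n z = z \<longleftrightarrow> z \<in> zeros (\<lambda>z. A z + {B z})" for n z
    unfolding T_def by (rule forward_backward_fixed_iff[OF A \<gamma>(1)])

  obtain z0 where "Tg z0 = z0" using assms(4) Tg_fix by auto
  then obtain w p where w: "\<And>k. Tg (w k) = (1 + 1 / real (Suc k)) *\<^sub>R w k" "w \<longlonglongrightarrow> p"
    and p: "Tg p = p" and p_min: "\<And>z. Tg z = z \<Longrightarrow> (norm (p - z))\<^sup>2 \<le> (norm z)\<^sup>2 - (norm p)\<^sup>2"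
    using tikhonov_path_converges[of Tg z0] Tg_nonexp by metis
  have proj: "projection (zeros (\<lambda>z. A z + {B z})) 0 = p"
    using p p_min by (intro projection_0_eqI) (auto simp flip: Tg_fix)
  have T_p: "T n p = p" for n using p by (simp add: T_fix Tg_fix)

  have step: "norm (x (Suc n) - p) \<le> norm (u n - p)" for n
  proof -
    have "x (Suc n) - p = ((1 - lam n) *\<^sub>R u n + lam n *\<^sub>R T n (u n)) - ((1 - lam n) *\<^sub>R p + lam n *\<^sub>R T n p)"
      by (simp add: x_Suc T_p algebra_simps)
    thus ?thesis
      using relaxed_forward_backward_nonexpansive[OF A B \<gamma>(1), of "lam n" n "u n" p] lam[of n] by (simp add: T_def)
  qed
  \<comment> \<open>The ball of radius \<open>M\<close> around \<open>p\<close> contains \<open>x 0\<close> and the origin, so shrinking towards the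
    origin does not leave it.\<close>
  define M where "M = max (norm (x 0 - p)) (norm p)"
  have u_M: "norm (u n - p) \<le> M" if "norm (x n - p) \<le> M" for n
  proof -
    have "b n * norm (x n - p) + (1 - b n) * norm p \<le> b n * M + (1 - b n) * M"
      using that b[of n] by (intro add_mono mult_left_mono) (auto simp: M_def)
    also have "\<dots> = M" by (simp add: algebra_simps)
    finally show ?thesis using tikhonov_step_norm(1)[of "b n" "x n" p] b[of n] by (simp add: u_def)
  qed
  have x_M: "norm (x n - p) \<le> M" for n
  proof (induction n)
    case (Suc n)
    show ?case using step[of n] u_M[OF Suc.IH] by linarith
  qed (simp add: M_def)
  have R: "norm (x n) \<le> M + norm p" "norm (u n) \<le> M + norm p" for n
    using norm_triangle_ineq2[of "x n" p] norm_triangle_ineq2[of "u n" p] x_M u_M[OF x_M, of n] by (auto simp: algebra_simps intro: order_trans)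
  have displacement: "norm (u n - F (u n)) \<le> 2 * M"
    if "\<And>v v'. norm (F v - F v') \<le> norm (v - v')" "F p = p" for F n
  proof -
    have "norm (u n - F (u n)) \<le> norm (u n - p) + norm (F p - F (u n))"
      using norm_triangle_ineq[of "u n - p" "p - F (u n)"] that(2) by simp
    also have "\<dots> \<le> norm (u n - p) + norm (p - u n)" using that(1) by simp
    finally show ?thesis using u_M[OF x_M, of n] by (simp add: norm_minus_commute)
  qed

  have "(\<lambda>n. 1 / \<gamma> n) \<longlonglongrightarrow> 1 / g" using g by (intro tendsto_intros) auto
  then obtain C where C: "\<And>n. norm (1 / \<gamma> n) \<le> C"
    using convergent_imp_Bseq[of "\<lambda>n. 1 / \<gamma> n"] by (auto simp: convergent_def Bseq_def)
  have reg: "(\<lambda>n. x (Suc n) - x n) \<longlonglongrightarrow> 0"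
  proof (rule asymptotic_regularity[OF A B _ b b_div assms(9) lam assms(12) \<gamma>(1) _ assms(15)])
    show "x (Suc n) = (1 - lam n) *\<^sub>R b n *\<^sub>R x n + lam n *\<^sub>R forward_backward (\<gamma> n) A B (b n *\<^sub>R x n)" for n
      using x_Suc by (simp add: u_def T_def)
    show "1 / \<gamma> n \<le> C" for n using C[of n] \<gamma>(1)[of n] by simp
    show "norm (x n) \<le> M + norm p" for n by (rule R)
    show "norm (b n *\<^sub>R x n - forward_backward (\<gamma> m) A B (b n *\<^sub>R x n)) \<le> 2 * M" for m n
      using displacement[of "T m", OF T_nonexp T_p] by (simp add: u_def T_def)
  qed

  \<comment> \<open>Since \<open>lam\<close> stays away from \<open>0\<close>, the small steps force small forward-backward displacements.\<close>
  have "(\<lambda>n. u n - x (Suc n)) \<longlonglongrightarrow> 0"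
  proof -
    have "(\<lambda>n. (b n - 1) *\<^sub>R x n) \<longlonglongrightarrow> 0"
    proof (rule Lim_null_comparison)
      show "\<forall>\<^sub>F n in sequentially. norm ((b n - 1) *\<^sub>R x n) \<le> \<bar>b n - 1\<bar> * (M + norm p)"
        using R by (auto intro!: always_eventually mult_left_mono)
      have "(\<lambda>n. \<bar>b n - 1\<bar> * (M + norm p)) \<longlonglongrightarrow> \<bar>1 - 1\<bar> * (M + norm p)" by (intro tendsto_intros b_lim)
      thus "(\<lambda>n. \<bar>b n - 1\<bar> * (M + norm p)) \<longlonglongrightarrow> 0" by simp
    qed
    from tendsto_diff[OF this reg] show ?thesis by (simp add: u_def algebra_simps)
  qed
  hence "(\<lambda>n. (1 / lam n) *\<^sub>R (u n - x (Suc n))) \<longlonglongrightarrow> (1 / l) *\<^sub>R 0"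
    using l by (intro tendsto_intros) auto
  moreover have "(1 / lam n) *\<^sub>R (u n - x (Suc n)) = u n - T n (u n)" for n
  proof -
    have "u n - x (Suc n) = lam n *\<^sub>R (u n - T n (u n))" by (simp add: x_Suc algebra_simps)
    thus ?thesis using lam[of n] by simp
  qed
  ultimately have T_reg: "(\<lambda>n. u n - T n (u n)) \<longlonglongrightarrow> 0" by simp
  have "(\<lambda>n. Tg (u n) - T n (u n)) \<longlonglongrightarrow> 0"
  proof (rule Lim_null_comparison)
    show "\<forall>\<^sub>F n in sequentially. norm (Tg (u n) - T n (u n)) \<le> \<bar>g - \<gamma> n\<bar> / g * (2 * M)"
    proof (intro always_eventually allI)
      fix n
      have "norm (Tg (u n) - T n (u n)) \<le> \<bar>g - \<gamma> n\<bar> / g * norm (u n - Tg (u n))"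
        unfolding Tg_def T_def by (rule forward_backward_step_size_change[OF A g(2) \<gamma>(1)])
      also have "\<dots> \<le> \<bar>g - \<gamma> n\<bar> / g * (2 * M)"
        using displacement[of Tg, OF Tg_nonexp p] g(2) by (intro mult_left_mono) auto
      finally show "norm (Tg (u n) - T n (u n)) \<le> \<bar>g - \<gamma> n\<bar> / g * (2 * M)" .
    qed
    have "(\<lambda>n. \<bar>g - \<gamma> n\<bar> / g * (2 * M)) \<longlonglongrightarrow> \<bar>g - g\<bar> / g * (2 * M)"
      using g by (intro tendsto_intros) auto
    thus "(\<lambda>n. \<bar>g - \<gamma> n\<bar> / g * (2 * M)) \<longlonglongrightarrow> 0" by simp
  qed
  from tendsto_diff[OF T_reg this] have Tg_reg: "(\<lambda>n. u n - Tg (u n)) \<longlonglongrightarrow> 0" by simp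

  have "(\<lambda>n. (norm (x n - p))\<^sup>2) \<longlonglongrightarrow> 0"
  proof (rule perturbed_recursion_tendsto_0[where \<theta> = "\<lambda>n. 1 - b n" and \<delta> = "\<lambda>n. - 2 * inner p (u n - p)"
        and \<eta> = "\<lambda>_. 0"])
    show "0 \<le> 1 - b n \<and> 1 - b n \<le> 1" for n using b[of n] by simp
    show "\<forall>\<^sub>F n in sequentially. - 2 * inner p (u n - p) \<le> e" if "e > 0" for e
      using asymptotic_fixed_points_half_space[OF Tg_nonexp w R(2) Tg_reg, of "e / 2"] that
      by (auto elim!: eventually_mono)
    show "(norm (x (Suc n) - p))\<^sup>2
        \<le> (1 - (1 - b n)) * (norm (x n - p))\<^sup>2 + (1 - b n) * (- 2 * inner p (u n - p)) + 0" for n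
    proof -
      have "(norm (x (Suc n) - p))\<^sup>2 \<le> (norm (u n - p))\<^sup>2" using step by (simp add: power_mono)
      also have "\<dots> \<le> b n * (norm (x n - p))\<^sup>2 - 2 * (1 - b n) * inner p (u n - p)"
        unfolding u_def using b[of n] by (intro tikhonov_step_norm(2)) auto
      finally show ?thesis by (simp add: algebra_simps)
    qed
  qed (use b_div in auto)
  hence "(\<lambda>n. sqrt ((norm (x n - p))\<^sup>2)) \<longlonglongrightarrow> sqrt 0" by (intro tendsto_intros)
  hence "x \<longlonglongrightarrow> p" by (simp add: tendsto_norm_zero_iff LIM_zero_iff)
  thus ?thesis by (simp add: proj)
qed

end
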